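(* Let $H_0,\dots,H_m\in\mathbb{R}^{n\times n}$ be symmetric matrices and let $G(\delta)=H_0+\sum_{i=1}^m\delta_iH_i$ for $\delta\in\mathbb{R}^m$. Let $L^\star$, with $n\times n$ blocks $L^\star_{ij}$ ($0\le i,j\le m$), be an optimal solution of the dual problem (D) and let $d^\star$ be the optimal value of (D). If $\operatorname{rank}(L^\star)=\operatorname{rank}(L^\star_{00})$, then $G(\delta)\ge 0$ for all $\delta$ in the unit cube $\{\delta\in\mathbb{R}^m\mid|\delta_i|\le 1\text{ for all } i\}$ if and only if $d^\star\ge 0$.
   Context: The dual problem (D) is the following semidefinite program over symmetric matrices $L\in\mathbb{R}^{n(m+1)\times n(m+1)}$ partitioned into $n\times n$ blocks $L=(L_{ij})_{i,j=0}^m$: minimize $\operatorname{trace}(HL)$ subject to $L\ge 0$; $L_{ij}=L_{ji}$ for $i,j=0,\dots,m$; $L_{ii}=L_{00}$ for $i=1,\dots,m$; and $\operatorname{trace}(L_{00})=1$. Here $$H=\begin{bmatrix}H_0&\tfrac12H_1&\cdots&\tfrac12H_m\\ \tfrac12H_1&0&\cdots&0\\ \vdots&&\ddots&\vdots\\ \tfrac12H_m&0&\cdots&0\end{bmatrix}.$$ For a symmetric matrix $X$, $X\ge 0$ means positive semidefinite. *)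

theory Defs
  imports "HOL-Analysis.Analysis"
begin

text \<open>
  The dimensions \<open>n\<close> and \<open>m\<close> are the cardinalities of the finite index types \<open>'n\<close> and \<open>'m\<close>.
  The block indices \<open>0, 1, ..., m\<close> are the elements of \<open>'m option\<close>: \<open>None\<close> is \<open>0\<close> and
  \<open>Some i\<close> runs through \<open>1, ..., m\<close>. The row and column indices of a matrix of size
  \<open>n(m+1)\<close> are pairs consisting of a block index and a position inside the block.
\<close>

type_synonym ('n, 'm) block_matrix = "real ^ ('m option \<times> 'n) ^ ('m option \<times> 'n)"

definition block :: "('n::finite, 'm::finite) block_matrix \<Rightarrow> 'm option \<Rightarrow> 'm option \<Rightarrow> real ^ 'n ^ 'n" where
  "block L i j = (\<chi> a b. L $ (i, a) $ (j, b))"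

definition symmetric_matrix :: "real ^ 'k ^ 'k::finite \<Rightarrow> bool" where
  "symmetric_matrix A \<longleftrightarrow> transpose A = A"

definition psd :: "real ^ 'k ^ 'k::finite \<Rightarrow> bool" where
  "psd A \<longleftrightarrow> symmetric_matrix A \<and> (\<forall>x. 0 \<le> x \<bullet> (A *v x))"

definition affine_G :: "('m::finite option \<Rightarrow> real ^ 'n ^ 'n) \<Rightarrow> real ^ 'm \<Rightarrow> real ^ 'n ^ 'n" where
  "affine_G H \<delta> = H None + (\<Sum>i\<in>UNIV. \<delta> $ i *\<^sub>R H (Some i))"

definition unit_cube :: "(real ^ 'm) set" where
  "unit_cube = {\<delta>. \<forall>i. \<bar>\<delta> $ i\<bar> \<le> 1}"

definition dual_cost_block ::
    "('m option \<Rightarrow> real ^ 'n ^ 'n) \<Rightarrow> 'm option \<Rightarrow> 'm option \<Rightarrow> real ^ 'n ^ 'n" where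
  "dual_cost_block H i j =
     (case (i, j) of
        (None, None) \<Rightarrow> H None
      | (None, Some l) \<Rightarrow> (1/2) *\<^sub>R H (Some l)
      | (Some k, None) \<Rightarrow> (1/2) *\<^sub>R H (Some k)
      | (Some k, Some l) \<Rightarrow> 0)"

definition dual_cost_matrix ::
    "('m::finite option \<Rightarrow> real ^ 'n ^ 'n) \<Rightarrow> ('n::finite, 'm) block_matrix" where
  "dual_cost_matrix H = (\<chi> p q. dual_cost_block H (fst p) (fst q) $ snd p $ snd q)"

definition dual_objective ::
    "('m::finite option \<Rightarrow> real ^ 'n ^ 'n) \<Rightarrow> ('n::finite, 'm) block_matrix \<Rightarrow> real" where
  "dual_objective H L = trace (dual_cost_matrix H ** L)"

definition dual_feasible :: "('n::finite, 'm::finite) block_matrix set" where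
  "dual_feasible =
     {L. psd L \<and>
         (\<forall>i j. block L i j = block L j i) \<and>
         (\<forall>i. block L (Some i) (Some i) = block L None None) \<and>
         trace (block L None None) = 1}"

definition dual_optimal ::
    "('m::finite option \<Rightarrow> real ^ 'n ^ 'n) \<Rightarrow> ('n::finite, 'm) block_matrix \<Rightarrow> bool" where
  "dual_optimal H L \<longleftrightarrow>
     L \<in> dual_feasible \<and> (\<forall>M\<in>dual_feasible. dual_objective H L \<le> dual_objective H M)"

text \<open>
  The infimum is taken in the reals, so it is meaningful only if the feasible set is nonempty
  and the objective is bounded below on it; the existence of an optimal solution ensures both.
\<close>

definition dual_value :: "('m::finite option \<Rightarrow> real ^ 'n::finite ^ 'n) \<Rightarrow> real" where
  "dual_value H = (INF L\<in>dual_feasible. dual_objective H L)"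

end

theory Submission
  imports Defs
begin

text \<open>
  If the rank of \<open>L\<close> equals that of \<open>S = L\<^sub>0\<^sub>0\<close>, every column of \<open>L\<close> lies in the span of the first
  block column, so that \<open>L\<^sub>j\<^sub>i = L\<^sub>j\<^sub>0 W\<^sub>i\<close> for suitable \<open>W\<^sub>i\<close>. The constraints of the dual problem
  say that modulo \<open>S\<close> the \<open>W\<^sub>i\<close> are commuting self-adjoint involutions. Their joint spectral
  projections split \<open>S\<close> into positive semidefinite parts on which each \<open>W\<^sub>i\<close> acts as a sign;
  each part contributes \<open>trace (G(s) M) \<ge> 0\<close> to the objective, \<open>s\<close> being a vertex of the cube.
  Conversely, for a vector \<open>x\<close> the minimum of \<open>x \<bullet> G(\<delta>) x\<close> over the cube is attained at a
  vertex \<open>s\<close>, and the blocks \<open>s\<^sub>i s\<^sub>j x x\<^sup>T\<close> form a dual feasible point with this value.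
\<close>

section \<open>Positive semidefinite matrices\<close>

definition outer :: "real ^ 'k \<Rightarrow> real ^ 'k ^ 'k::finite" where
  "outer v = (\<chi> i j. v $ i * v $ j)"

lemma outer_mult_vec: "outer v *v x = (v \<bullet> x) *\<^sub>R v"
  by (simp add: outer_def matrix_vector_mult_def inner_vec_def vec_eq_iff sum_distrib_left
      sum_distrib_right mult_ac)

lemma trace_mult_outer: "trace (A ** outer v) = v \<bullet> (A *v v)"
  by (simp add: trace_def outer_def matrix_matrix_mult_def matrix_vector_mult_def inner_vec_def
      sum_distrib_left mult_ac)

lemma trace_outer: "trace (outer v) = v \<bullet> v"
  by (simp add: trace_def outer_def inner_vec_def)

lemma trace_scaleR: "trace (c *\<^sub>R A) = c * trace (A :: real ^ 'k ^ 'k::finite)"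
  by (simp add: trace_def sum_distrib_left)

lemma matrix_mult_scaleR_right:
  fixes A :: "real ^ 'k ^ 'l" and B :: "real ^ 'j ^ 'k"
  shows "A ** (c *\<^sub>R B) = c *\<^sub>R (A ** B)"
  by (simp add: matrix_scalar_ac scalar_matrix_assoc)

lemma matrix_add_rdistrib:
  fixes A B :: "real ^ 'k ^ 'l" and C :: "real ^ 'j ^ 'k"
  shows "(A + B) ** C = A ** C + B ** C"
  by (simp add: matrix_matrix_mult_def vec_eq_iff distrib_right sum.distrib)

lemma transpose_add: "transpose (A + B) = transpose A + transpose (B :: real ^ 'k ^ 'l)"
  by (simp add: transpose_def vec_eq_iff)

lemma psd_outer: "psd (outer v)"
proof -
  have "transpose (outer v) = outer v"
    by (simp add: outer_def transpose_def vec_eq_iff mult.commute)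
  then show ?thesis
    by (simp add: psd_def symmetric_matrix_def outer_mult_vec inner_commute[of _ v])
qed

lemma psd_scaleR: "0 \<le> c \<Longrightarrow> psd A \<Longrightarrow> psd (c *\<^sub>R A)"
  by (simp add: psd_def symmetric_matrix_def transpose_scalar flip: scaleR_matrix_vector_assoc)

lemma symmetric_matrix_entry:
  assumes "symmetric_matrix A"
  shows "A $ i $ j = A $ j $ i"
proof -
  have "A $ i $ j = transpose A $ j $ i" by (simp add: transpose_def)
  then show ?thesis using assms by (simp add: symmetric_matrix_def)
qed

lemma symmetric_matrix_inner:
  assumes "symmetric_matrix A"
  shows "x \<bullet> (A *v y) = y \<bullet> (A *v x)"
  by (metis assms dot_lmul_matrix inner_commute symmetric_matrix_def transpose_matrix_vector)

lemma psd_congruence: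
  assumes "psd M"
  shows "psd (Q ** M ** transpose Q)"
proof -
  have "x \<bullet> ((Q ** M ** transpose Q) *v x) = (transpose Q *v x) \<bullet> (M *v (transpose Q *v x))" for x
    by (simp add: dot_lmul_matrix flip: matrix_vector_mul_assoc)
  moreover have "transpose (Q ** M ** transpose Q) = Q ** M ** transpose Q"
    using assms by (simp add: psd_def symmetric_matrix_def matrix_transpose_mul matrix_mul_assoc)
  ultimately show ?thesis
    using assms by (simp add: psd_def symmetric_matrix_def)
qed

lemma inner_axis_mult_axis: "axis i 1 \<bullet> (M *v axis j 1) = (M :: real ^ 'k::finite ^ 'l::finite) $ i $ j"
  by (simp add: matrix_vector_mult_basis column_def inner_axis')

lemma psd_diagonal_nonneg: "psd M \<Longrightarrow> 0 \<le> M $ k $ k"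
  by (metis inner_axis_mult_axis psd_def)

text \<open>At the vector \<open>axis i 1 + t *\<^sub>R axis j 1\<close> the quadratic form is
  linear in \<open>t\<close>, namely \<open>2 * t * M $ i $ j\<close>. Nonnegativity at
  \<open>t = 1\<close> and \<open>t = -1\<close> kills the entry.\<close>

lemma psd_zero_diagonal:
  assumes "psd M" and "\<And>k. M $ k $ k = 0"
  shows "M = 0"
proof -
  have "M $ i $ j = 0" for i j
  proof -
    have sym: "M $ j $ i = M $ i $ j"
      using symmetric_matrix_inner[of M "axis j 1" "axis i 1"] assms(1)
      by (simp add: psd_def inner_axis_mult_axis)
    have "0 \<le> (axis i 1 + t *\<^sub>R axis j 1) \<bullet> (M *v (axis i 1 + t *\<^sub>R axis j 1))" for t
      using assms(1) by (simp add: psd_def)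
    also have "(axis i 1 + t *\<^sub>R axis j 1) \<bullet> (M *v (axis i 1 + t *\<^sub>R axis j 1)) = 2 * t * M $ i $ j" for t
      by (simp add: matrix_vector_right_distrib matrix_vector_mult_scaleR inner_add_left
          inner_add_right inner_axis_mult_axis assms(2) sym)
    finally have "0 \<le> 2 * t * M $ i $ j" for t .
    from this[of 1] this[of "-1"] show ?thesis by simp
  qed
  then show ?thesis by (simp add: vec_eq_iff)
qed

text \<open>The reduced form at \<open>x\<close> is the minimum of the form of \<open>M\<close>
  along the line through \<open>x\<close> in direction \<open>axis k 1\<close>, hence
  nonnegative.\<close>

lemma psd_schur_complement:
  assumes "psd M" and pos: "0 < M $ k $ k"
  shows "psd (M - (1 / M $ k $ k) *\<^sub>R outer (M *v axis k 1))"
proof -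
  define d where "d = M $ k $ k"
  define v where "v = M *v axis k 1"
  have d: "0 < d" "axis k 1 \<bullet> v = d"
    using pos by (simp_all add: d_def v_def inner_axis_mult_axis)
  have sym: "symmetric_matrix M" using assms(1) by (simp add: psd_def)
  have "0 \<le> x \<bullet> ((M - (1 / d) *\<^sub>R outer v) *v x)" for x
  proof -
    \<comment> \<open>This \<open>t\<close> minimizes the quadratic polynomial in \<open>t\<close>
      computed below.\<close>
    define t where "t = (v \<bullet> x) / d"
    have "axis k 1 \<bullet> (M *v x) = v \<bullet> x"
      using symmetric_matrix_inner[OF sym, of "axis k 1" x] by (simp add: v_def inner_commute)
    then have "(x - t *\<^sub>R axis k 1) \<bullet> (M *v (x - t *\<^sub>R axis k 1))
        = x \<bullet> (M *v x) - 2 * t * (v \<bullet> x) + t * t * d"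
      using d by (simp add: matrix_vector_mult_diff_distrib matrix_vector_mult_scaleR inner_diff_left
          inner_diff_right inner_commute[of x v] algebra_simps flip: v_def)
    also have "\<dots> = x \<bullet> (M *v x) - (v \<bullet> x) * (v \<bullet> x) / d"
      using d by (simp add: t_def field_simps)
    also have "\<dots> = x \<bullet> ((M - (1 / d) *\<^sub>R outer v) *v x)"
      by (simp add: matrix_vector_mult_diff_rdistrib outer_mult_vec inner_diff_right inner_commute
          flip: scaleR_matrix_vector_assoc)
    finally show ?thesis using assms(1) by (metis psd_def)
  qed
  moreover have "transpose (M - (1 / d) *\<^sub>R outer v) = M - (1 / d) *\<^sub>R outer v"
    using sym psd_outer[of v] unfolding psd_def symmetric_matrix_def
    by (simp add: transpose_def vec_eq_iff)
  ultimately show ?thesis by (simp add: psd_def symmetric_matrix_def d_def v_def)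
qed

text \<open>In place of a spectral decomposition, rank-one terms are peeled off \<open>M\<close> by
  Schur complements. Each contributes a nonnegative multiple of \<open>v \<bullet> (A *v v)\<close>,
  and the number of nonzero diagonal entries drops until \<open>M\<close> vanishes.\<close>

lemma trace_mult_psd_nonneg:
  assumes "psd A" and "psd M"
  shows "0 \<le> trace (A ** M)"
  using assms(2)
proof (induction "card {k. M $ k $ k \<noteq> 0}" arbitrary: M rule: less_induct)
  case less
  show ?case
  proof (cases "\<forall>k. M $ k $ k = 0")
    case True
    then have "M = 0" using psd_zero_diagonal less.prems by blast
    then show ?thesis by (simp add: trace_def matrix_matrix_mult_def)
  next
    case False
    then obtain k where k: "M $ k $ k \<noteq> 0" by blast
    then have pos: "0 < M $ k $ k"
      using psd_diagonal_nonneg[OF less.prems, of k] by simp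
    define v where "v = M *v axis k 1"
    define N where "N = M - (1 / M $ k $ k) *\<^sub>R outer v"
    have N: "psd N" unfolding N_def v_def using less.prems pos by (rule psd_schur_complement)
    have diag: "N $ j $ j = M $ j $ j - (M $ j $ k)\<^sup>2 / M $ k $ k" for j
      by (simp add: N_def v_def outer_def matrix_vector_mult_basis column_def power2_eq_square)
    have "N $ k $ k = 0" using k by (simp add: diag power2_eq_square)
    \<comment> \<open>Diagonal entries only decrease and stay nonnegative, so no zero is
      lost.\<close>
    moreover have "N $ j $ j = 0" if "M $ j $ j = 0" for j
    proof -
      have "0 \<le> (M $ j $ k)\<^sup>2 / M $ k $ k" using pos by simp
      then show ?thesis using diag[of j] that psd_diagonal_nonneg[OF N, of j] by linarith
    qed
    ultimately have "{j. N $ j $ j \<noteq> 0} \<subset> {j. M $ j $ j \<noteq> 0}" using k by blast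
    then have "card {j. N $ j $ j \<noteq> 0} < card {j. M $ j $ j \<noteq> 0}"
      by (intro psubset_card_mono) auto
    then have "0 \<le> trace (A ** N)" using less.hyps N by blast
    moreover have "0 \<le> (1 / M $ k $ k) * (v \<bullet> (A *v v))"
      using assms(1) pos by (simp add: psd_def)
    moreover have "M = N + (1 / M $ k $ k) *\<^sub>R outer v" by (simp add: N_def)
    then have "trace (A ** M) = trace (A ** N) + (1 / M $ k $ k) * (v \<bullet> (A *v v))"
      by (metis matrix_add_ldistrib matrix_mult_scaleR_right trace_add trace_mult_outer trace_scaleR)
    ultimately show ?thesis by linarith
  qed
qed

section \<open>Commuting involutions\<close>

lemma trace_affine_G_mult:
  "trace (affine_G H \<delta> ** M) = trace (H None ** M) + (\<Sum>i\<in>UNIV. \<delta> $ i * trace (H (Some i) ** M))"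
proof -
  have "trace ((\<Sum>i\<in>I. \<delta> $ i *\<^sub>R H (Some i)) ** M) = (\<Sum>i\<in>I. \<delta> $ i * trace (H (Some i) ** M))"
    if "finite I" for I
    using that
    by (induction I)
      (simp_all add: matrix_add_rdistrib trace_add trace_scaleR flip: scalar_matrix_assoc,
       simp add: trace_def matrix_matrix_mult_def)
  then show ?thesis by (simp add: affine_G_def matrix_add_rdistrib trace_add)
qed

text \<open>\<open>J\<close> holds the indices whose action need not yet be a scalar. Each induction
  step splits \<open>M\<close> into the two eigenparts of one \<open>W k\<close>; once
  \<open>J\<close> is empty, the scalars form a point of the cube and the sum is the trace of a
  product of two positive semidefinite matrices. All relations carry the factor \<open>M\<close>
  because they hold only modulo \<open>M\<close>.\<close>

lemma trace_commuting_involutions_nonneg: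
  fixes H :: "'m::finite option \<Rightarrow> real ^ 'n::finite ^ 'n" and W :: "'m \<Rightarrow> real ^ 'n ^ 'n"
  assumes G: "\<And>\<delta>. \<delta> \<in> unit_cube \<Longrightarrow> psd (affine_G H \<delta>)"
    and "finite J" and "psd M"
    and "\<And>i. transpose (M ** W i) = M ** W i"
    and "\<And>i. M ** W i ** W i = M"
    and "\<And>i j. M ** W i ** W j = M ** W j ** W i"
    and "\<And>i. i \<notin> J \<Longrightarrow> \<exists>s. \<bar>s\<bar> \<le> 1 \<and> M ** W i = s *\<^sub>R M"
  shows "0 \<le> trace (H None ** M) + (\<Sum>i\<in>UNIV. trace (H (Some i) ** (M ** W i)))"
  using assms(2-)
proof (induction J arbitrary: M rule: finite_induct)
  case empty
  then obtain s where s: "\<And>i. \<bar>s i\<bar> \<le> 1" "\<And>i. M ** W i = s i *\<^sub>R M"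
    by (metis empty_iff)
  have "0 \<le> trace (affine_G H (\<chi> i. s i) ** M)"
    using s empty.prems by (intro trace_mult_psd_nonneg G) (auto simp: unit_cube_def)
  then show ?case
    by (simp add: trace_affine_G_mult s matrix_mult_scaleR_right trace_scaleR)
next
  case (insert k J)
  have M: "transpose M = M" using insert.prems(1) by (simp add: psd_def symmetric_matrix_def)
  have swap: "transpose (W i) ** M = M ** W i" for i
    using insert.prems(2)[of i] M by (simp add: matrix_transpose_mul)
  \<comment> \<open>The transposed projection onto the eigenvalue \<open>e\<close> of
    \<open>W k\<close>. Acting from the left, it lets \<open>N e\<close> inherit the relations
    between \<open>M\<close> and the \<open>W i\<close> by associativity; by \<open>swap\<close> it
    equals the projection acting from the right.\<close>
  define Q where "Q e = (1/2) *\<^sub>R (mat 1 + e *\<^sub>R transpose (W k))" for e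
  define N where "N e = Q e ** M" for e
  have N: "N e = (1/2) *\<^sub>R (M + e *\<^sub>R (M ** W k))" for e
    by (simp add: N_def Q_def matrix_add_rdistrib swap flip: scalar_matrix_assoc)
  have NW: "N e ** W j = (1/2) *\<^sub>R (M ** W j + e *\<^sub>R (M ** W k ** W j))" for e j
    by (simp add: N matrix_add_rdistrib flip: scalar_matrix_assoc)
  have nonneg: "0 \<le> trace (H None ** N e) + (\<Sum>i\<in>UNIV. trace (H (Some i) ** (N e ** W i)))"
    if e: "e = 1 \<or> e = -1" for e
  proof (rule insert.IH)
    have "transpose (Q e) = (1/2) *\<^sub>R (mat 1 + e *\<^sub>R W k)"
      by (simp add: Q_def transpose_scalar transpose_add)
    \<comment> \<open>The projection is idempotent modulo \<open>M\<close>, so \<open>N e\<close> is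
      a congruence transform of \<open>M\<close> and thus positive semidefinite.\<close>
    then have "Q e ** M ** transpose (Q e) = (1/2) *\<^sub>R (N e + e *\<^sub>R (N e ** W k))"
      by (simp add: matrix_add_ldistrib matrix_mult_scaleR_right flip: N_def)
    also have "\<dots> = N e"
      using e by (auto simp: NW insert.prems(3)) (auto simp: N vec_eq_iff field_simps)
    finally show "psd (N e)" using psd_congruence[OF insert.prems(1)] by metis
    show "transpose (N e ** W i) = N e ** W i" for i
    proof -
      \<comment> \<open>A product of commuting self-adjoint maps is self-adjoint.\<close>
      have "transpose (M ** W k ** W i) = transpose (W i) ** transpose (M ** W k)"
        by (rule matrix_transpose_mul)
      also have "\<dots> = M ** W k ** W i"
        by (metis insert.prems(2,4) matrix_mul_assoc swap)
      finally show ?thesis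
        by (simp add: NW transpose_scalar transpose_add insert.prems(2))
    qed
    show "N e ** W i ** W i = N e" for i
      by (simp add: N_def insert.prems(3) flip: matrix_mul_assoc)
        (simp add: insert.prems(3) matrix_mul_assoc)
    show "N e ** W i ** W j = N e ** W j ** W i" for i j
      by (metis N_def insert.prems(4) matrix_mul_assoc)
    show "\<exists>s. \<bar>s\<bar> \<le> 1 \<and> N e ** W i = s *\<^sub>R N e" if notJ: "i \<notin> J" for i
    proof (cases "i = k")
      case True
      have "N e ** W i = e *\<^sub>R N e"
        unfolding True NW using e by (auto simp: N insert.prems(3) algebra_simps)
      then show ?thesis using e by (intro exI[of _ e]) auto
    next
      case False
      then obtain s where "\<bar>s\<bar> \<le> 1" "M ** W i = s *\<^sub>R M"
        using insert.prems(5)[of i] notJ by blast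
      moreover from this have "N e ** W i = s *\<^sub>R N e"
        by (simp add: N_def matrix_mult_scaleR_right flip: matrix_mul_assoc)
      ultimately show ?thesis by blast
    qed
  qed
  have "M = N 1 + N (-1)" by (simp add: N vec_eq_iff field_simps)
  then have split: "trace (A ** (M ** B)) = trace (A ** (N 1 ** B)) + trace (A ** (N (-1) ** B))" for A B
    by (metis matrix_add_ldistrib matrix_add_rdistrib trace_add)
  have "trace (H None ** M) = trace (H None ** N 1) + trace (H None ** N (-1))"
    using split[of "H None" "mat 1"] by simp
  then show ?case
    using nonneg[of 1] nonneg[of "-1"] by (simp add: split sum.distrib)
qed

section \<open>The dual problem\<close>

lemma sum_option: "(\<Sum>i\<in>UNIV. f i) = f None + (\<Sum>i\<in>UNIV. f (Some i))"
  for f :: "'m::finite option \<Rightarrow> real"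
  by (simp add: UNIV_option_conv sum.reindex)

lemma sum_pairs: "(\<Sum>p\<in>UNIV. f p) = (\<Sum>i\<in>UNIV. \<Sum>a\<in>UNIV. f (i, a))"
  for f :: "'i::finite \<times> 'a::finite \<Rightarrow> real"
  by (simp add: sum.cartesian_product)

text \<open>The halves of \<open>H (Some i)\<close> in the first block row and the first block
  column meet equal blocks of \<open>L\<close> and add up.\<close>

lemma dual_objective_blocks:
  fixes H :: "'m::finite option \<Rightarrow> real ^ 'n::finite ^ 'n"
  assumes sym: "\<And>i j. block L i j = block L j i"
  shows "dual_objective H L =
    trace (H None ** block L None None) + (\<Sum>i\<in>UNIV. trace (H (Some i) ** block L None (Some i)))"
proof -
  have "dual_objective H L = (\<Sum>i\<in>UNIV. \<Sum>j\<in>UNIV. trace (dual_cost_block H i j ** block L j i))"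
  proof -
    have "dual_objective H L = (\<Sum>i\<in>UNIV. \<Sum>a\<in>UNIV. \<Sum>j\<in>UNIV. \<Sum>b\<in>UNIV.
        dual_cost_block H i j $ a $ b * L $ (j, b) $ (i, a))"
      by (simp add: dual_objective_def dual_cost_matrix_def trace_def matrix_matrix_mult_def
          sum_pairs)
    also have "\<dots> = (\<Sum>i\<in>UNIV. \<Sum>j\<in>UNIV. \<Sum>a\<in>UNIV. \<Sum>b\<in>UNIV.
        dual_cost_block H i j $ a $ b * L $ (j, b) $ (i, a))"
      by (intro sum.cong refl sum.swap)
    finally show ?thesis by (simp add: trace_def matrix_matrix_mult_def block_def)
  qed
  also have "\<dots> = trace (H None ** block L None None)
      + (\<Sum>i\<in>UNIV. trace (H (Some i) ** block L None (Some i)))"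
    by (simp add: sum_option dual_cost_block_def sym[of "Some _" None] trace_scaleR sum.distrib
        flip: scalar_matrix_assoc sum_distrib_left sum_divide_distrib)
      (simp add: trace_def matrix_matrix_mult_def)
  finally show ?thesis .
qed

section \<open>Consequences of the rank condition\<close>

text \<open>The image \<open>T\<close> of the first block column projects onto the range of the
  corner block, so its dimension is at least \<open>rank L\<close>. Being contained in the range of
  \<open>L\<close>, it is all of it.\<close>

lemma block_column_factor:
  fixes L :: "('n::finite, 'm::finite) block_matrix"
  assumes "rank L = rank (block L None None)"
  obtains W where "\<And>j i. block L j i = block L j None ** W i"
proof -
  define E :: "real ^ 'n \<Rightarrow> real ^ ('m option \<times> 'n)"
    where "E z = (\<chi> p. if fst p = None then z $ snd p else 0)" for z
  define P :: "real ^ ('m option \<times> 'n) \<Rightarrow> real ^ 'n" where "P y = (\<chi> a. y $ (None, a))" for y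
  have lin: "linear E" "linear P"
    by (auto intro!: linearI simp: E_def P_def vec_eq_iff)
  have LE: "(L *v E z) $ (j, a) = (\<Sum>c\<in>UNIV. L $ (j, a) $ (None, c) * z $ c)" for z j a
  proof -
    have "(L *v E z) $ (j, a) = (\<Sum>i\<in>UNIV. \<Sum>c\<in>UNIV. L $ (j, a) $ (i, c) * E z $ (i, c))"
      by (simp add: matrix_vector_mult_def sum_pairs)
    then show ?thesis by (simp add: sum_option E_def)
  qed
  define T where "T = range (\<lambda>z. L *v E z)"
  have linT: "linear (\<lambda>z. L *v E z)"
    using linear_compose[OF lin(1) matrix_vector_mul_linear[of L]] by (simp add: o_def)
  have "P (L *v E z) = block L None None *v z" for z
    by (simp add: P_def LE) (simp add: block_def matrix_vector_mult_def)
  then have "P ` T = range ((*v) (block L None None))"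
    by (simp add: T_def image_image)
  then have "rank L \<le> dim T"
    using dim_image_le[OF lin(2), of T] assms by (simp add: rank_dim_range)
  then have "T = range ((*v) L)"
    by (intro subspace_dim_equal)
      (auto simp: T_def rank_dim_range intro!: linear_subspace_image linT subspace_UNIV)
  then have "\<exists>z. L *v axis p 1 = L *v E z" for p
    unfolding T_def by blast
  then obtain z where z: "\<And>p. L *v axis p 1 = L *v E (z p)" by metis
  \<comment> \<open>Column \<open>b\<close> of the factor holds the coefficients expressing column
    \<open>(i, b)\<close> of \<open>L\<close> through the first block column; they do not depend on
    \<open>j\<close>.\<close>
  have "block L j i = block L j None ** (\<chi> c b. z (i, b) $ c)" for i j
  proof -
    have "L $ (j, a) $ (i, b) = (\<Sum>c\<in>UNIV. L $ (j, a) $ (None, c) * z (i, b) $ c)" for a b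
      using arg_cong[OF z[of "(i, b)"], of "\<lambda>y. y $ (j, a)"]
      by (simp add: LE matrix_vector_mult_basis column_def)
    then show ?thesis by (simp add: block_def matrix_matrix_mult_def vec_eq_iff)
  qed
  then show ?thesis by (rule that)
qed

lemma dual_objective_nonneg:
  fixes H :: "'m::finite option \<Rightarrow> real ^ 'n::finite ^ 'n"
  assumes G: "\<And>\<delta>. \<delta> \<in> unit_cube \<Longrightarrow> psd (affine_G H \<delta>)"
    and L: "L \<in> dual_feasible" and rank: "rank L = rank (block L None None)"
  shows "0 \<le> dual_objective H L"
proof -
  have psd: "psd L" and sym: "\<And>i j. block L i j = block L j i"
    and diag: "\<And>i. block L (Some i) (Some i) = block L None None"
    using L by (auto simp: dual_feasible_def)
  have entry: "L $ p $ q = L $ q $ p" for p q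
    using psd by (simp add: psd_def symmetric_matrix_entry)
  have tr: "transpose (block L i j) = block L i j" for i j
  proof -
    have "transpose (block L i j) = block L j i"
      by (simp add: transpose_def block_def vec_eq_iff entry)
    then show ?thesis using sym by simp
  qed
  obtain W where W: "\<And>j i. block L j i = block L j None ** W i"
    using block_column_factor[OF rank] by blast
  define M where "M = block L None None"
  define V where "V i = W (Some i)" for i
  have MV: "M ** V i = block L None (Some i)" for i
    by (simp add: M_def V_def W[of None "Some i"])
  \<comment> \<open>Block symmetry turns \<open>M ** V i\<close> into the block at
    \<open>(Some i, None)\<close>, to which the factorization applies again.\<close>
  have MVV: "M ** V i ** V j = block L (Some i) (Some j)" for i j
    by (metis MV V_def W sym)
  have "psd M"
  proof -
    have "0 \<le> x \<bullet> (M *v x)" for x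
    proof -
      define y :: "real ^ ('m option \<times> 'n)"
        where "y = (\<chi> p. if fst p = None then x $ snd p else 0)"
      have "y \<bullet> (L *v y) = (\<Sum>i\<in>UNIV. \<Sum>a\<in>UNIV. y $ (i, a) * (\<Sum>j\<in>UNIV. \<Sum>b\<in>UNIV. L $ (i, a) $ (j, b) * y $ (j, b)))"
        by (simp add: inner_vec_def matrix_vector_mult_def sum_pairs)
      also have "\<dots> = x \<bullet> (M *v x)"
        by (simp add: sum_option y_def inner_vec_def matrix_vector_mult_def M_def block_def)
      finally show ?thesis using psd by (metis psd_def)
    qed
    then show ?thesis using tr by (simp add: psd_def symmetric_matrix_def M_def)
  qed
  then have "0 \<le> trace (H None ** M) + (\<Sum>i\<in>UNIV. trace (H (Some i) ** (M ** V i)))"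
  \<comment> \<open>With \<open>J = UNIV\<close> no action has to be scalar at the start. Equal
    diagonal blocks make each \<open>V i\<close> an involution modulo \<open>M\<close>; block
    symmetry makes them commute and, with the symmetry of \<open>L\<close>, self-adjoint.\<close>
  proof (intro trace_commuting_involutions_nonneg[where J = UNIV] G)
    show "transpose (M ** V i) = M ** V i" for i by (simp only: MV tr)
    show "M ** V i ** V i = M" for i using diag by (simp add: MVV) (simp add: M_def)
    show "M ** V i ** V j = M ** V j ** V i" for i j by (simp only: MVV sym)
  qed auto
  then show ?thesis
    using dual_objective_blocks[OF sym, of H] by (simp add: MV flip: M_def)
qed

section \<open>Dual points from vertices of the cube\<close>

lemma vertex_dual_feasible:
  fixes H :: "'m::finite option \<Rightarrow> real ^ 'n::finite ^ 'n" and s :: "real ^ 'm"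
  assumes s: "\<And>i. (s $ i)\<^sup>2 = 1" and x: "x \<noteq> 0"
  obtains M where "M \<in> dual_feasible"
    and "dual_objective H M = (x \<bullet> (affine_G H s *v x)) / (x \<bullet> x)"
proof -
  \<comment> \<open>The vertex is extended by 1 at block index \<open>None\<close>, so block
    \<open>(None, Some i)\<close> carries the factor \<open>s $ i\<close>. Dividing by
    \<open>x \<bullet> x\<close> gives the corner block trace 1.\<close>
  define t where "t = case_option 1 (($) s)"
  have t: "t None = 1" "\<And>i. t (Some i) = s $ i" by (simp_all add: t_def)
  define M :: "('n, 'm) block_matrix"
    where "M = (1 / (x \<bullet> x)) *\<^sub>R outer (\<chi> p. t (fst p) * x $ snd p)"
  have blk: "block M i j = (t i * t j / (x \<bullet> x)) *\<^sub>R outer x" for i j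
    by (simp add: M_def block_def outer_def vec_eq_iff)
  have sym: "block M i j = block M j i" for i j
    by (simp add: blk mult.commute)
  have "psd M" unfolding M_def by (intro psd_scaleR psd_outer) simp
  then have "M \<in> dual_feasible"
    using s x by (auto simp: dual_feasible_def blk t trace_scaleR trace_outer power2_eq_square mult.commute)
  moreover have "dual_objective H M = (x \<bullet> (affine_G H s *v x)) / (x \<bullet> x)"
    unfolding dual_objective_blocks[OF sym] trace_mult_outer[symmetric] trace_affine_G_mult
    by (simp add: blk t matrix_mult_scaleR_right trace_scaleR add_divide_distrib sum_divide_distrib)
  ultimately show ?thesis by (rule that)
qed

lemma affine_G_inner:
  "x \<bullet> (affine_G H \<delta> *v x) = x \<bullet> (H None *v x) + (\<Sum>i\<in>UNIV. \<delta> $ i * (x \<bullet> (H (Some i) *v x)))"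
  by (simp add: trace_affine_G_mult flip: trace_mult_outer)

text \<open>For fixed \<open>x\<close> the form is affine in \<open>\<delta>\<close>, so it is
  bounded below by its value at a vertex, which is \<open>x \<bullet> x\<close> times a dual
  objective value.\<close>

lemma psd_affine_G_of_dual:
  fixes H :: "'m::finite option \<Rightarrow> real ^ 'n::finite ^ 'n"
  assumes sym: "\<And>i. symmetric_matrix (H i)"
    and nonneg: "\<And>M. M \<in> dual_feasible \<Longrightarrow> 0 \<le> dual_objective H M"
    and \<delta>: "\<delta> \<in> unit_cube"
  shows "psd (affine_G H \<delta>)"
proof -
  have "0 \<le> x \<bullet> (affine_G H \<delta> *v x)" for x
  proof (cases "x = 0")
    case False
    define q where "q i = x \<bullet> (H (Some i) *v x)" for i
    \<comment> \<open>Signs opposite to \<open>q i\<close> minimize each summand; a zero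
      \<open>q i\<close> gets -1 rather than 0 so that \<open>s\<close> stays a vertex.\<close>
    define s :: "real ^ 'm" where "s = (\<chi> i. if q i \<ge> 0 then -1 else 1)"
    have "(s $ i)\<^sup>2 = 1" for i by (simp add: s_def)
    then obtain M where "M \<in> dual_feasible"
      "dual_objective H M = (x \<bullet> (affine_G H s *v x)) / (x \<bullet> x)"
      using vertex_dual_feasible[OF _ False] by metis
    moreover have "0 < x \<bullet> x" using False by simp
    ultimately have "0 \<le> x \<bullet> (affine_G H s *v x)"
      using nonneg[of M] by (simp add: zero_le_divide_iff del: inner_gt_zero_iff)
    also have "\<dots> \<le> x \<bullet> (affine_G H \<delta> *v x)"
    proof -
      have "s $ i * q i \<le> \<delta> $ i * q i" for i
      proof -
        have "\<bar>\<delta> $ i\<bar> \<le> 1" using \<delta> by (simp add: unit_cube_def)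
        then show ?thesis
          by (auto simp: s_def abs_le_iff intro: mult_right_mono mult_right_mono_neg
              dest: mult_right_mono[of "-1" "\<delta> $ i" "q i"] mult_right_mono_neg[of "\<delta> $ i" 1 "q i"])
      qed
      then show ?thesis by (simp add: affine_G_inner sum_mono flip: q_def)
    qed
    finally show ?thesis .
  qed simp
  moreover have "transpose (affine_G H \<delta>) = affine_G H \<delta>"
  proof -
    have "H i $ a $ b = H i $ b $ a" for i a b
      using sym by (rule symmetric_matrix_entry)
    then show ?thesis
      by (simp add: affine_G_def transpose_def vec_eq_iff)
  qed
  ultimately show ?thesis by (simp add: psd_def symmetric_matrix_def)
qed

theorem theorem16:
  fixes H :: "'m::finite option \<Rightarrow> real ^ 'n::finite ^ 'n"
    and L :: "('n, 'm) block_matrix"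
  assumes "\<And>i. symmetric_matrix (H i)"
    and "dual_optimal H L"
    and "rank L = rank (block L None None)"
  shows "(\<forall>\<delta>\<in>unit_cube. psd (affine_G H \<delta>)) \<longleftrightarrow> dual_value H \<ge> 0"
proof -
  have L: "L \<in> dual_feasible" "\<And>M. M \<in> dual_feasible \<Longrightarrow> dual_objective H L \<le> dual_objective H M"
    using assms(2) by (auto simp: dual_optimal_def)
  \<comment> \<open>The infimum is attained at \<open>L\<close>, so both directions concern the sign
    of its objective value.\<close>
  then have "dual_value H = dual_objective H L"
    unfolding dual_value_def by (intro cInf_eq_minimum) auto
  moreover have "0 \<le> dual_objective H L" if "\<forall>\<delta>\<in>unit_cube. psd (affine_G H \<delta>)"
    using dual_objective_nonneg[OF _ L(1) assms(3)] that by blast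
  moreover have "psd (affine_G H \<delta>)" if "0 \<le> dual_objective H L" "\<delta> \<in> unit_cube" for \<delta>
    by (rule psd_affine_G_of_dual[OF assms(1) order_trans[OF that(1) L(2)] that(2)])
  ultimately show ?thesis by auto
qed

end
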